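(* Let $\mathcal{A}$ be a nonnegative weakly irreducible tensor of order $m$ and dimension $n$, with spectral radius $\rho(\mathcal{A})$. Then the projective eigenvariety $\mathbb{V}_{\rho(\mathcal{A})}(\mathcal{A})\subseteq\mathbb{P}^{n-1}$ has dimension zero, i.e. there are finitely many eigenvectors of $\mathcal{A}$ corresponding to $\rho(\mathcal{A})$ up to a scalar.
   Context: Let $m\ge 2$, $n\ge 1$, $[n]=\{1,\dots,n\}$. A tensor of order $m$ and dimension $n$ is an array $\mathcal{A}=(a_{i_1i_2\ldots i_m})$ of complex numbers indexed by $i_1,\dots,i_m\in[n]$; it is nonnegative if all its entries are nonnegative reals. For $\mathbf{x}\in\mathbb{C}^n$, $\mathcal{A}\mathbf{x}^{m-1}\in\mathbb{C}^n$ is defined by $(\mathcal{A}\mathbf{x}^{m-1})_i=\sum_{i_2,\dots,i_m\in[n]}a_{ii_2\cdots i_m}x_{i_2}\cdots x_{i_m}$, and $\mathbf{x}^{[m-1]}=(x_1^{m-1},\dots,x_n^{m-1})$. A number $\lambda\in\mathbb{C}$ is an eigenvalue of $\mathcal{A}$ if $\mathcal{A}\mathbf{x}^{m-1}=\lambda\mathbf{x}^{[m-1]}$ for some nonzero $\mathbf{x}\in\mathbb{C}^n$, which is called an eigenvector associated with (corresponding to) $\lambda$. The spectral radius $\rho(\mathcal{A})$ is the largest modulus of an eigenvalue of $\mathcal{A}$ (for a nonnegative tensor, $\rho(\mathcal{A})$ is itself an eigenvalue). The projective eigenvariety associated with an eigenvalue $\lambda$ is $\mathbb{V}_\lambda(\mathcal{A})=\{\mathbf{x}\in\mathbb{P}^{n-1}:\mathcal{A}\mathbf{x}^{m-1}=\lambda\mathbf{x}^{[m-1]}\}$,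 where $\mathbb{P}^{n-1}$ is complex projective space. The dimension of a variety is its dimension as a Zariski topological space. The directed graph $G(\mathcal{A})$ has vertex set $[n]$, and $(i,j)$ is an arc if and only if there is a nonzero entry $a_{ii_2\ldots i_m}$ with $j\in\{i_2,\dots,i_m\}$. The tensor $\mathcal{A}$ is weakly irreducible if $G(\mathcal{A})$ is strongly connected. *)

theory Defs
  imports "HOL-Analysis.Analysis" "Graph_Theory.Digraph_Component"
begin

section \<open>Tensors and their eigenvalues\<close>

text \<open>
  A tensor of order \<open>m\<close> and dimension \<open>CARD('n)\<close> is given by its entries
  \<open>A [i\<^sub>1, \<dots>, i\<^sub>m]\<close>. Only index lists of length \<open>m\<close> are ever inspected; the
  values of \<open>A\<close> at lists of any other length are irrelevant.
\<close>

type_synonym 'n tensor = "'n list \<Rightarrow> complex"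

definition nonneg_tensor :: "nat \<Rightarrow> 'n::finite tensor \<Rightarrow> bool" where
  "nonneg_tensor m A \<longleftrightarrow> (\<forall>is. length is = m \<longrightarrow> A is \<in> \<real>\<^sub>\<ge>\<^sub>0)"

definition tensor_apply :: "nat \<Rightarrow> 'n::finite tensor \<Rightarrow> complex ^ 'n \<Rightarrow> complex ^ 'n" where
  "tensor_apply m A x =
     (\<chi> i. \<Sum>js | length js = m - 1. A (i # js) * prod_list (map (\<lambda>j. x $ j) js))"

definition hadamard_power :: "complex ^ 'n::finite \<Rightarrow> nat \<Rightarrow> complex ^ 'n" where
  "hadamard_power x k = (\<chi> i. (x $ i) ^ k)"

definition is_eigenvector :: "nat \<Rightarrow> 'n::finite tensor \<Rightarrow> complex \<Rightarrow> complex ^ 'n \<Rightarrow> bool" where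
  "is_eigenvector m A \<mu> x \<longleftrightarrow>
     x \<noteq> 0 \<and> tensor_apply m A x = \<mu> *s hadamard_power x (m - 1)"

definition is_eigenvalue :: "nat \<Rightarrow> 'n::finite tensor \<Rightarrow> complex \<Rightarrow> bool" where
  "is_eigenvalue m A \<mu> \<longleftrightarrow> (\<exists>x. is_eigenvector m A \<mu> x)"

definition tensor_spectral_radius :: "nat \<Rightarrow> 'n::finite tensor \<Rightarrow> real" where
  "tensor_spectral_radius m A = Sup (cmod ` {\<mu>. is_eigenvalue m A \<mu>})"

definition tensor_digraph :: "nat \<Rightarrow> 'n::finite tensor \<Rightarrow> ('n, 'n \<times> 'n) pre_digraph" where
  "tensor_digraph m A =
     \<lparr> verts = UNIV,
       arcs = {(i, j). \<exists>js. length js = m - 1 \<and> A (i # js) \<noteq> 0 \<and> j \<in> set js},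
       tail = fst, head = snd \<rparr>"

definition weakly_irreducible :: "nat \<Rightarrow> 'n::finite tensor \<Rightarrow> bool" where
  "weakly_irreducible m A \<longleftrightarrow> strongly_connected (tensor_digraph m A)"


section \<open>Complex projective space with its Zariski topology\<close>

text \<open>
  The points of projective space are the lines through the origin of \<open>complex ^ 'n\<close>.
\<close>

definition projective_space :: "(complex ^ 'n::finite) set set" where
  "projective_space = {vec.span {x} | x. x \<noteq> 0}"

text \<open>
  Homogeneous polynomials of degree \<open>d\<close> in the variables \<open>x $ i\<close>, as functions;
  \<open>\<alpha>\<close> ranges over the exponent vectors of total degree \<open>d\<close>. As the ground field is
  infinite, polynomials and polynomial functions can be identified.
\<close>

definition homogeneous_poly :: "nat \<Rightarrow> (complex ^ 'n::finite \<Rightarrow> complex) \<Rightarrow> bool" where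
  "homogeneous_poly d f \<longleftrightarrow>
     (\<exists>c :: ('n \<Rightarrow> nat) \<Rightarrow> complex.
        \<forall>x. f x = (\<Sum>\<alpha> | (\<Sum>i\<in>UNIV. \<alpha> i) = d. c \<alpha> * (\<Prod>i\<in>UNIV. (x $ i) ^ \<alpha> i)))"

definition proj_zero_locus ::
    "(complex ^ 'n::finite \<Rightarrow> complex) set \<Rightarrow> (complex ^ 'n) set set" where
  "proj_zero_locus F = {L \<in> projective_space. \<forall>f\<in>F. \<forall>x\<in>L. f x = 0}"

definition proj_algebraic_set :: "(complex ^ 'n::finite) set set \<Rightarrow> bool" where
  "proj_algebraic_set V \<longleftrightarrow>
     (\<exists>F. (\<forall>f\<in>F. \<exists>d. homogeneous_poly d f) \<and> V = proj_zero_locus F)"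

definition zariski_topology :: "(complex ^ 'n::finite) set topology" where
  "zariski_topology =
     topology (\<lambda>U. U \<subseteq> projective_space \<and> proj_algebraic_set (projective_space - U))"

definition projective_eigenvariety ::
    "nat \<Rightarrow> 'n::finite tensor \<Rightarrow> complex \<Rightarrow> (complex ^ 'n) set set" where
  "projective_eigenvariety m A \<mu> =
     {L \<in> projective_space.
        \<forall>x\<in>L. tensor_apply m A x = \<mu> *s hadamard_power x (m - 1)}"

subsection \<open>The Zariski-closed sets are exactly the algebraic sets\<close>

lemma finite_exponents: "finite {\<alpha> :: 'n::finite \<Rightarrow> nat. (\<Sum>i\<in>UNIV. \<alpha> i) = d}"
proof (rule finite_subset)
  show "{\<alpha> :: 'n \<Rightarrow> nat. (\<Sum>i\<in>UNIV. \<alpha> i) = d} \<subseteq> Pi\<^sub>E UNIV (\<lambda>_. {..d})"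
    by (auto intro!: member_le_sum)
  show "finite (Pi\<^sub>E (UNIV :: 'n set) (\<lambda>_. {..d}))"
    by (intro finite_PiE) auto
qed

lemma homogeneous_poly_mult:
  fixes f g :: "complex ^ 'n::finite \<Rightarrow> complex"
  assumes "homogeneous_poly d f" "homogeneous_poly e g"
  shows "homogeneous_poly (d + e) (\<lambda>x. f x * g x)"
proof -
  define S :: "nat \<Rightarrow> ('n \<Rightarrow> nat) set" where "S k = {\<alpha>. (\<Sum>i\<in>UNIV. \<alpha> i) = k}" for k
  define M :: "('n \<Rightarrow> nat) \<Rightarrow> complex ^ 'n \<Rightarrow> complex"
    where "M \<alpha> x = (\<Prod>i\<in>UNIV. (x $ i) ^ \<alpha> i)" for \<alpha> x
  define plus where "plus = (\<lambda>p :: ('n \<Rightarrow> nat) \<times> ('n \<Rightarrow> nat). \<lambda>i. fst p i + snd p i)"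
  have fin: "finite (S k)" for k
    unfolding S_def by (rule finite_exponents)
  obtain a where a: "\<And>x. f x = (\<Sum>\<alpha>\<in>S d. a \<alpha> * M \<alpha> x)"
    using assms(1) unfolding homogeneous_poly_def S_def M_def by blast
  obtain b where b: "\<And>x. g x = (\<Sum>\<beta>\<in>S e. b \<beta> * M \<beta> x)"
    using assms(2) unfolding homogeneous_poly_def S_def M_def by blast
  define c where "c \<gamma> = (\<Sum>p | p \<in> S d \<times> S e \<and> plus p = \<gamma>. a (fst p) * b (snd p))" for \<gamma>
  have M: "M (plus p) x = M (fst p) x * M (snd p) x" for p x
    by (simp add: M_def plus_def power_add prod.distrib)
  have img: "plus ` (S d \<times> S e) \<subseteq> S (d + e)"
    by (auto simp: S_def plus_def sum.distrib)
  have "f x * g x = (\<Sum>\<gamma>\<in>S (d + e). c \<gamma> * M \<gamma> x)" for x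
  proof -
    have "f x * g x = (\<Sum>p\<in>S d \<times> S e. a (fst p) * b (snd p) * M (plus p) x)"
      by (simp add: a b M sum_product sum.cartesian_product case_prod_unfold mult_ac)
    also have "\<dots> = (\<Sum>\<gamma>\<in>S (d + e). \<Sum>p | p \<in> S d \<times> S e \<and> plus p = \<gamma>.
                       a (fst p) * b (snd p) * M (plus p) x)"
      by (rule sum.group[symmetric]) (use fin img in auto)
    also have "\<dots> = (\<Sum>\<gamma>\<in>S (d + e). c \<gamma> * M \<gamma> x)"
      unfolding c_def sum_distrib_right by (intro sum.cong) auto
    finally show ?thesis .
  qed
  then show ?thesis
    unfolding homogeneous_poly_def S_def M_def by blast
qed

lemma homogeneous_poly_scale:
  assumes "homogeneous_poly d f"
  shows "f (k *s x) = k ^ d * f x"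
proof -
  obtain c where c: "\<And>x. f x = (\<Sum>\<alpha> | (\<Sum>i\<in>UNIV. \<alpha> i) = d. c \<alpha> * (\<Prod>i\<in>UNIV. (x $ i) ^ \<alpha> i))"
    using assms unfolding homogeneous_poly_def by blast
  show ?thesis
    unfolding c sum_distrib_left
    by (intro sum.cong)
      (auto simp: power_mult_distrib prod.distrib power_sum[symmetric] mult_ac)
qed

lemma homogeneous_poly_const:
  "homogeneous_poly 0 (\<lambda>x :: complex ^ 'a::finite. k)"
proof -
  have "{\<alpha> :: 'a \<Rightarrow> nat. (\<Sum>i\<in>UNIV. \<alpha> i) = 0} = {\<lambda>_. 0}"
    by (auto simp: fun_eq_iff)
  then show ?thesis
    unfolding homogeneous_poly_def by (intro exI[of _ "\<lambda>_. k"]) simp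
qed

lemma homogeneous_poly_vanish_mult:
  assumes "homogeneous_poly d f" "homogeneous_poly e g" "L \<in> projective_space"
  shows "(\<forall>x\<in>L. f x * g x = 0) \<longleftrightarrow> (\<forall>x\<in>L. f x = 0) \<or> (\<forall>x\<in>L. g x = 0)"
proof
  assume *: "\<forall>x\<in>L. f x * g x = 0"
  obtain v where v: "L = vec.span {v}"
    using assms(3) unfolding projective_space_def by blast
  have "v \<in> L" unfolding v by (simp add: vec.span_base)
  hence "f v = 0 \<or> g v = 0" using * by auto
  then show "(\<forall>x\<in>L. f x = 0) \<or> (\<forall>x\<in>L. g x = 0)"
    unfolding v vec.span_singleton
    by (auto simp: homogeneous_poly_scale[OF assms(1)] homogeneous_poly_scale[OF assms(2)])
qed auto

lemma proj_algebraic_set_empty: "proj_algebraic_set {}"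
proof -
  have "proj_zero_locus {\<lambda>_. 1} = {}"
    unfolding proj_zero_locus_def projective_space_def using vec.span_zero by fastforce
  then show ?thesis
    unfolding proj_algebraic_set_def using homogeneous_poly_const
    by (intro exI[of _ "{\<lambda>_. 1}"]) auto
qed

lemma proj_algebraic_set_Un:
  assumes "proj_algebraic_set V" "proj_algebraic_set W"
  shows "proj_algebraic_set (V \<union> W)"
proof -
  obtain F where F: "\<And>f. f \<in> F \<Longrightarrow> \<exists>d. homogeneous_poly d f" "V = proj_zero_locus F"
    using assms(1) unfolding proj_algebraic_set_def by blast
  obtain G where G: "\<And>g. g \<in> G \<Longrightarrow> \<exists>d. homogeneous_poly d g" "W = proj_zero_locus G"
    using assms(2) unfolding proj_algebraic_set_def by blast
  define H where "H = {\<lambda>x. f x * g x | f g. f \<in> F \<and> g \<in> G}"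
  have hom: "\<exists>d. homogeneous_poly d h" if "h \<in> H" for h
    using that F(1) G(1) homogeneous_poly_mult unfolding H_def by blast
  have "L \<in> V \<union> W \<longleftrightarrow> L \<in> proj_zero_locus H" for L
  proof (cases "L \<in> projective_space")
    case L: True
    have "L \<in> proj_zero_locus H \<longleftrightarrow> (\<forall>f\<in>F. \<forall>g\<in>G. \<forall>x\<in>L. f x * g x = 0)"
    proof
      assume "L \<in> proj_zero_locus H"
      then have *: "h x = 0" if "h \<in> H" "x \<in> L" for h x
        using that by (simp add: proj_zero_locus_def)
      show "\<forall>f\<in>F. \<forall>g\<in>G. \<forall>x\<in>L. f x * g x = 0"
      proof (intro ballI)
        fix f g x assume "f \<in> F" "g \<in> G" "x \<in> L"
        then have "(\<lambda>x. f x * g x) \<in> H"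
          unfolding H_def by blast
        from *[OF this \<open>x \<in> L\<close>] show "f x * g x = 0" .
      qed
    next
      assume *: "\<forall>f\<in>F. \<forall>g\<in>G. \<forall>x\<in>L. f x * g x = 0"
      show "L \<in> proj_zero_locus H"
        unfolding proj_zero_locus_def
      proof (intro CollectI conjI ballI L)
        fix h x assume "h \<in> H" "x \<in> L"
        from \<open>h \<in> H\<close> obtain f g where "f \<in> F" "g \<in> G" "h = (\<lambda>x. f x * g x)"
          unfolding H_def by blast
        then show "h x = 0"
          using * \<open>x \<in> L\<close> by simp
      qed
    qed
    also have "\<dots> \<longleftrightarrow> (\<forall>f\<in>F. \<forall>g\<in>G. (\<forall>x\<in>L. f x = 0) \<or> (\<forall>x\<in>L. g x = 0))"
    proof (intro ball_cong refl)
      fix f g assume "f \<in> F" "g \<in> G"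
      then obtain d e where "homogeneous_poly d f" "homogeneous_poly e g"
        using F(1) G(1) by blast
      then show "(\<forall>x\<in>L. f x * g x = 0) \<longleftrightarrow> (\<forall>x\<in>L. f x = 0) \<or> (\<forall>x\<in>L. g x = 0)"
        using L by (rule homogeneous_poly_vanish_mult)
    qed
    also have "\<dots> \<longleftrightarrow> L \<in> V \<union> W"
      unfolding F(2) G(2) proj_zero_locus_def using L by blast
    finally show ?thesis by simp
  qed (auto simp: F(2) G(2) proj_zero_locus_def)
  then show ?thesis
    unfolding proj_algebraic_set_def using hom by blast
qed

lemma proj_algebraic_set_Inter:
  assumes "\<And>V. V \<in> \<V> \<Longrightarrow> proj_algebraic_set V"
  shows "proj_algebraic_set (projective_space \<inter> \<Inter>\<V>)"
proof -
  obtain F where F: "\<And>V. V \<in> \<V> \<Longrightarrow>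
      (\<forall>f\<in>F V. \<exists>d. homogeneous_poly d f) \<and> V = proj_zero_locus (F V)"
    using assms unfolding proj_algebraic_set_def by metis
  have "L \<in> projective_space \<inter> \<Inter>\<V> \<longleftrightarrow> L \<in> proj_zero_locus (\<Union>(F ` \<V>))" for L
  proof -
    have "L \<in> V \<longleftrightarrow> L \<in> projective_space \<and> (\<forall>f\<in>F V. \<forall>x\<in>L. f x = 0)" if "V \<in> \<V>" for V
      using F[OF that] unfolding proj_zero_locus_def by blast
    then show ?thesis
      unfolding proj_zero_locus_def by blast
  qed
  then have "projective_space \<inter> \<Inter>\<V> = proj_zero_locus (\<Union>(F ` \<V>))"
    by blast
  moreover have "\<forall>f\<in>\<Union>(F ` \<V>). \<exists>d. homogeneous_poly d f"
    using F by blast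
  ultimately show ?thesis
    unfolding proj_algebraic_set_def by (intro exI[of _ "\<Union>(F ` \<V>)"] conjI)
qed

lemma istopology_zariski:
  "istopology (\<lambda>U. U \<subseteq> projective_space \<and>
      proj_algebraic_set ((projective_space :: (complex ^ 'n::finite) set set) - U))"
  unfolding istopology_def
proof (intro conjI allI impI)
  fix S T :: "(complex ^ 'n) set set"
  assume S: "S \<subseteq> projective_space \<and> proj_algebraic_set (projective_space - S)"
    and T: "T \<subseteq> projective_space \<and> proj_algebraic_set (projective_space - T)"
  show "S \<inter> T \<subseteq> projective_space"
    using S by blast
  show "proj_algebraic_set (projective_space - S \<inter> T)"
    unfolding Diff_Int by (rule proj_algebraic_set_Un) (use S T in simp_all)
next
  fix \<K> :: "(complex ^ 'n) set set set"
  assume K: "\<forall>K\<in>\<K>. K \<subseteq> projective_space \<and> proj_algebraic_set (projective_space - K)"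
  then show "\<Union>\<K> \<subseteq> projective_space" by blast
  have eq: "projective_space - \<Union>\<K> =
      projective_space \<inter> \<Inter>((\<lambda>K. projective_space - K) ` \<K>)"
    by blast
  show "proj_algebraic_set (projective_space - \<Union>\<K>)"
    by (subst eq, rule proj_algebraic_set_Inter) (use K in blast)
qed

lemma openin_zariski:
  "openin zariski_topology U \<longleftrightarrow>
     U \<subseteq> projective_space \<and> proj_algebraic_set (projective_space - U)"
  unfolding zariski_topology_def by (simp add: topology_inverse'[OF istopology_zariski])

lemma topspace_zariski: "topspace zariski_topology = projective_space"
proof
  show "topspace zariski_topology \<subseteq> projective_space"
    using openin_topspace[of zariski_topology] unfolding openin_zariski by (rule conjunct1)
  show "projective_space \<subseteq> topspace zariski_topology"
    by (rule openin_subset) (simp add: openin_zariski proj_algebraic_set_empty)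
qed

lemma closedin_zariski: "closedin zariski_topology V \<longleftrightarrow> proj_algebraic_set V"
proof -
  have "V \<subseteq> projective_space" if "proj_algebraic_set V"
    using that unfolding proj_algebraic_set_def proj_zero_locus_def by blast
  then show ?thesis
    by (auto simp: closedin_def topspace_zariski openin_zariski double_diff)
qed


section \<open>Dimension of a topological space\<close>

definition irreducible_in :: "'a topology \<Rightarrow> 'a set \<Rightarrow> bool" where
  "irreducible_in X S \<longleftrightarrow>
     S \<subseteq> topspace X \<and> S \<noteq> {} \<and>
     (\<forall>C D. closedin X C \<and> closedin X D \<and> S \<subseteq> C \<union> D \<longrightarrow> S \<subseteq> C \<or> S \<subseteq> D)"

text \<open>
  The supremum of the lengths \<open>k\<close> of the chains \<open>Z 0 \<subset> Z 1 \<subset> \<dots> \<subset> Z k\<close> of irreducible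
  closed subsets. It is taken in \<^typ>\<open>ereal\<close>, so that the empty space has dimension
  \<open>-\<infinity>\<close> and not \<open>0\<close>.
\<close>

definition topological_dimension :: "'a topology \<Rightarrow> ereal" where
  "topological_dimension X =
     Sup {ereal (real k) | k. \<exists>Z :: nat \<Rightarrow> 'a set.
            (\<forall>i\<le>k. closedin X (Z i) \<and> irreducible_in X (Z i)) \<and>
            (\<forall>i<k. Z i \<subset> Z (Suc i))}"

end

theory Submission
  imports Defs
begin

text \<open>
  Write \<open>k = m - 1\<close>, let \<open>a\<close> be the real nonnegative tensor of entries and
  \<open>F x i = \<Sum> a (i, j\<^sub>1, \<dots>, j\<^sub>k) x j\<^sub>1 \<cdots> x j\<^sub>k\<close>. Weak irreducibility enters only through one
  principle (\<open>arc_closed_eq_UNIV\<close>): a nonempty set of indices that contains, with \<open>i\<close>, all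
  indices of every nonzero entry of slice \<open>i\<close>, is the whole index set.

  There is a positive eigenvector \<open>u\<close> (\<open>Perron_vector\<close>). Consider the positive vectors with
  \<open>F x \<le> r x\<^sup>k\<close> coordinatewise. If \<open>r\<close> is bounded and the smallest coordinate of \<open>x\<close> is \<open>1\<close>,
  the other coordinates are bounded as well, by propagation along arcs (\<open>Harnack\<close>);
  hence the least possible \<open>r\<close> is attained (\<open>optimal_supersolution\<close>). Among the vectors that
  attain it, take one with as few equalities as possible. Should equality fail somewhere, lowering
  a coordinate with strict inequality would make another equality strict. So equality holds
  everywhere.

  Comparing an arbitrary vector with \<open>u\<close> at the index where the ratio is largest shows that the
  eigenvalue \<open>r\<close> of \<open>u\<close> is the spectral radius, and that an eigenvector \<open>x\<close> for \<open>r\<close> satisfies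
  \<open>\<bar>x\<bar> = t u\<close> (\<open>subsolution_le_Perron\<close>). Then every triangle inequality in the eigenvalue equation
  is an equality, so the phases \<open>y = x / \<bar>x\<bar>\<close> satisfy \<open>y j\<^sub>1 \<cdots> y j\<^sub>k = y i\<^sup>k\<close> for each nonzero
  entry (\<open>Perron_eigenvector_polar\<close>).

  These multiplicative equations have finitely many solutions up to a common factor
  (\<open>finite_phase_solutions\<close>). Indeed, two solutions normalised at one index that are close to each
  other have a quotient whose arguments \<open>\<theta>\<close> are small, so that
  \<open>\<theta> j\<^sub>1 + \<cdots> + \<theta> j\<^sub>k = k \<theta> i\<close> holds exactly and not merely modulo \<open>2\<pi>\<close>; the maximum principle
  makes \<open>\<theta>\<close> constant, hence zero. The normalised solutions are thus uniformly discrete and bounded.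

  The eigenvariety is therefore a finite nonempty set of points, and points are Zariski closed,
  so its dimension is zero.
\<close>

section \<open>Elementary inequalities and their equality cases\<close>

lemma member_le_prod_list:
  fixes f :: "'a \<Rightarrow> real"
  assumes "\<And>j. j \<in> set js \<Longrightarrow> f j \<ge> 1" "l \<in> set js"
  shows "f l \<le> (\<Prod>j\<leftarrow>js. f j)"
  using assms
proof (induction js)
  case (Cons j js)
  have ge1: "(\<Prod>j\<leftarrow>js. f j) \<ge> 1"
    using Cons.prems(1) by (induction js) (auto intro!: mult_ge1_I)
  have "f j \<ge> 1" using Cons.prems by simp
  show ?case
  proof (cases "l = j")
    case True
    then show ?thesis
      using ge1 \<open>f j \<ge> 1\<close> by simp
  next
    case False
    with Cons have "f l \<le> (\<Prod>j\<leftarrow>js. f j)" by simp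
    also have "\<dots> \<le> f j * (\<Prod>j\<leftarrow>js. f j)"
      using ge1 \<open>f j \<ge> 1\<close> by simp
    finally show ?thesis by simp
  qed
qed simp

lemma prod_list_map_nonneg:
  fixes f :: "'a \<Rightarrow> real"
  shows "(\<And>j. j \<in> set js \<Longrightarrow> f j \<ge> 0) \<Longrightarrow> (\<Prod>j\<leftarrow>js. f j) \<ge> 0"
  by (induction js) auto

lemma prod_list_map_pos:
  fixes f :: "'a \<Rightarrow> real"
  shows "(\<And>j. j \<in> set js \<Longrightarrow> f j > 0) \<Longrightarrow> (\<Prod>j\<leftarrow>js. f j) > 0"
  by (induction js) auto

lemma prod_list_mono:
  fixes f g :: "'a \<Rightarrow> real"
  assumes "\<And>j. j \<in> set js \<Longrightarrow> 0 \<le> f j \<and> f j \<le> g j"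
  shows "(\<Prod>j\<leftarrow>js. f j) \<le> (\<Prod>j\<leftarrow>js. g j)"
  using assms
proof (induction js)
  case (Cons j js)
  then show ?case
    using prod_list_map_nonneg[of js f] by (auto intro!: mult_mono intro: order_trans)
qed simp

lemma prod_list_strict_mono:
  fixes f g :: "'a \<Rightarrow> real"
  assumes "\<And>j. j \<in> set js \<Longrightarrow> 0 \<le> f j \<and> f j \<le> g j \<and> 0 < g j" "l \<in> set js" "f l < g l"
  shows "(\<Prod>j\<leftarrow>js. f j) < (\<Prod>j\<leftarrow>js. g j)"
  using assms
proof (induction js)
  case (Cons j js)
  have j: "0 \<le> f j" "f j \<le> g j" "0 < g j" using Cons.prems by auto
  have pg: "(\<Prod>j\<leftarrow>js. g j) > 0"
    by (rule prod_list_map_pos) (use Cons.prems in auto)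
  have le: "(\<Prod>j\<leftarrow>js. f j) \<le> (\<Prod>j\<leftarrow>js. g j)"
    by (rule prod_list_mono) (use Cons.prems in auto)
  have nn: "(\<Prod>j\<leftarrow>js. f j) \<ge> 0"
    by (rule prod_list_map_nonneg) (use Cons.prems in auto)
  show ?case
  proof (cases "l \<in> set js")
    case True
    then have "(\<Prod>j\<leftarrow>js. f j) < (\<Prod>j\<leftarrow>js. g j)"
      using Cons by auto
    then have "g j * (\<Prod>j\<leftarrow>js. f j) < g j * (\<Prod>j\<leftarrow>js. g j)"
      using j by simp
    moreover have "f j * (\<Prod>j\<leftarrow>js. f j) \<le> g j * (\<Prod>j\<leftarrow>js. f j)"
      using j nn by (intro mult_right_mono)
    ultimately show ?thesis by simp
  next
    case False
    with Cons.prems have "f j < g j" by auto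
    then have "f j * (\<Prod>j\<leftarrow>js. g j) < g j * (\<Prod>j\<leftarrow>js. g j)"
      using pg by simp
    moreover have "f j * (\<Prod>j\<leftarrow>js. f j) \<le> f j * (\<Prod>j\<leftarrow>js. g j)"
      using j le by (intro mult_left_mono)
    ultimately show ?thesis by simp
  qed
qed simp

lemma prod_list_scale:
  fixes f :: "'a \<Rightarrow> 'b::comm_semiring_1"
  shows "(\<Prod>j\<leftarrow>js. c * f j) = c ^ length js * (\<Prod>j\<leftarrow>js. f j)"
  by (induction js) (simp_all add: mult_ac)

lemma prod_list_mult:
  fixes f g :: "'a \<Rightarrow> 'b::comm_semiring_1"
  shows "(\<Prod>j\<leftarrow>js. f j * g j) = (\<Prod>j\<leftarrow>js. f j) * (\<Prod>j\<leftarrow>js. g j)"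
  by (induction js) (simp_all add: mult_ac)

lemma of_real_prod_list: "complex_of_real (\<Prod>j\<leftarrow>js. f j) = (\<Prod>j\<leftarrow>js. complex_of_real (f j))"
  by (induction js) simp_all

lemma norm_prod_list: "cmod (\<Prod>j\<leftarrow>js. f j) = (\<Prod>j\<leftarrow>js. cmod (f j))"
  by (induction js) (simp_all add: norm_mult)

lemma prod_list_cis: "(\<Prod>j\<leftarrow>js. cis (\<theta> j)) = cis (\<Sum>j\<leftarrow>js. \<theta> j)"
  by (induction js) (simp_all add: cis_mult)

lemma abs_sum_list_le:
  fixes \<theta> :: "'a \<Rightarrow> real"
  assumes "\<And>j. j \<in> set js \<Longrightarrow> \<bar>\<theta> j\<bar> \<le> M"
  shows "\<bar>\<Sum>j\<leftarrow>js. \<theta> j\<bar> \<le> real (length js) * M"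
  using assms
proof (induction js)
  case (Cons j js)
  then have "\<bar>\<theta> j\<bar> \<le> M" "\<bar>\<Sum>j\<leftarrow>js. \<theta> j\<bar> \<le> real (length js) * M" by auto
  then show ?case by (simp add: algebra_simps)
qed simp

lemma sum_list_max_imp_eq:
  fixes \<theta> :: "'a \<Rightarrow> real"
  assumes "\<And>j. j \<in> set js \<Longrightarrow> \<theta> j \<le> M" "(\<Sum>j\<leftarrow>js. \<theta> j) \<ge> real (length js) * M" "l \<in> set js"
  shows "\<theta> l = M"
proof -
  have le: "(\<Sum>j\<leftarrow>js. \<theta> j) \<le> real (length js) * M" if "\<And>j. j \<in> set js \<Longrightarrow> \<theta> j \<le> M" for js
    using that
  proof (induction js)
    case (Cons j js)
    then have "\<theta> j \<le> M" "(\<Sum>j\<leftarrow>js. \<theta> j) \<le> real (length js) * M" by auto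
    then show ?case by (simp add: algebra_simps)
  qed simp
  obtain xs ys where js: "js = xs @ l # ys"
    using split_list[OF assms(3)] by blast
  have "(\<Sum>j\<leftarrow>xs. \<theta> j) \<le> real (length xs) * M" "(\<Sum>j\<leftarrow>ys. \<theta> j) \<le> real (length ys) * M" "\<theta> l \<le> M"
    using assms(1) js by (auto intro!: le)
  then show ?thesis
    using assms(2) js by (simp add: algebra_simps)
qed

lemma cis_inj_near:
  assumes "cis \<alpha> = cis \<beta>" "\<bar>\<alpha> - \<beta>\<bar> < 2 * pi"
  shows "\<alpha> = \<beta>"
proof -
  have "sin \<alpha> = sin \<beta> \<and> cos \<alpha> = cos \<beta>" using assms(1) by (simp add: complex_eq_iff)
  then obtain n :: int where n: "\<alpha> = \<beta> + 2 * pi * n" using sin_cos_eq_iff by blast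
  then have "\<bar>real_of_int n\<bar> < 1" using assms(2) by (simp add: abs_mult)
  then have "n = 0" by linarith
  with n show ?thesis by simp
qed

text \<open>
  A point of the unit circle is an extreme point of the disc, so it is a weighted mean of unit
  complex numbers only if all those of positive weight coincide with it. Rotating by \<open>cnj c\<close>
  turns the claim into one about real parts, each at most \<open>1\<close>.
\<close>

lemma weighted_mean_extreme:
  assumes fin: "finite S" and w: "\<And>s. s \<in> S \<Longrightarrow> (w s :: real) \<ge> 0"
    and z: "\<And>s. s \<in> S \<Longrightarrow> cmod (z s) = 1" and c: "cmod c = 1"
    and mean: "(\<Sum>s\<in>S. w s * z s) = (\<Sum>s\<in>S. w s) * c"
    and s: "s \<in> S" "w s \<noteq> 0"
  shows "z s = c"
proof -
  have cc: "c * cnj c = 1" using c by (simp add: complex_norm_square[symmetric])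
  have "(\<Sum>s\<in>S. w s * (z s * cnj c)) = (\<Sum>s\<in>S. w s * z s) * cnj c"
    by (simp add: sum_distrib_right mult.assoc)
  also have "\<dots> = (\<Sum>s\<in>S. w s)"
    unfolding mean by (simp add: mult.assoc cc)
  finally have "Re (\<Sum>s\<in>S. w s * (z s * cnj c)) = Re (complex_of_real (\<Sum>s\<in>S. w s))" by simp
  then have "(\<Sum>s\<in>S. w s * Re (z s * cnj c)) = (\<Sum>s\<in>S. w s)"
    by (simp add: algebra_simps)
  then have "(\<Sum>s\<in>S. w s * (1 - Re (z s * cnj c))) = 0"
    by (simp add: right_diff_distrib sum_subtractf)
  moreover have n1: "cmod (z s * cnj c) = 1" if "s \<in> S" for s
    using z[OF that] c by (simp add: norm_mult)
  moreover have "w s * (1 - Re (z s * cnj c)) \<ge> 0" if "s \<in> S" for s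
    using w[OF that] complex_Re_le_cmod[of "z s * cnj c"] n1[OF that] by (intro mult_nonneg_nonneg) auto
  ultimately have "w s * (1 - Re (z s * cnj c)) = 0"
    using sum_nonneg_eq_0_iff[OF fin, of "\<lambda>s. w s * (1 - Re (z s * cnj c))"] s(1) by auto
  then have re: "Re (z s * cnj c) = 1" using s(2) by simp
  then have "Im (z s * cnj c) = 0"
    using n1[OF s(1)] cmod_power2[of "z s * cnj c"] by simp
  with re have "z s * cnj c = 1" by (simp add: complex_eq_iff)
  then have "z s * (cnj c * c) = c" by (simp add: mult.assoc[symmetric])
  then show ?thesis using cc by (simp add: mult.commute)
qed

lemma span_singleton_scale:
  fixes v :: "complex ^ 'n::finite"
  assumes "c \<noteq> 0"
  shows "vec.span {c *s v} = vec.span {v}"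
proof -
  have "c *s v \<in> vec.span {v}" by (intro vec.span_scale vec.span_base) simp
  moreover have "inverse c *s (c *s v) \<in> vec.span {c *s v}" by (intro vec.span_scale vec.span_base) simp
  ultimately show ?thesis using assms by (simp add: vec.span_eq)
qed

section \<open>Nonnegative weakly irreducible tensors\<close>

definition tensor_form ::
    "nat \<Rightarrow> ('n::finite list \<Rightarrow> 'a::comm_semiring_1) \<Rightarrow> ('n \<Rightarrow> 'a) \<Rightarrow> 'n \<Rightarrow> 'a" where
  "tensor_form k a x i = (\<Sum>js | length js = k. a (i # js) * (\<Prod>j\<leftarrow>js. x j))"

lemma finite_index_lists: "finite {js :: 'n::finite list. length js = k}"
  using finite_lists_length_eq[of "UNIV :: 'n set" k] by simp

lemma tensor_form_scale: "tensor_form k a (\<lambda>j. c * x j) i = c ^ k * tensor_form k a x i"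
  unfolding tensor_form_def sum_distrib_left
  by (intro sum.cong) (auto simp: prod_list_scale mult_ac)

lemma continuous_on_tensor_form:
  fixes a :: "'n::finite list \<Rightarrow> real" and x :: "'n \<Rightarrow> 'b::topological_space \<Rightarrow> real"
  assumes "\<And>j. continuous_on T (x j)"
  shows "continuous_on T (\<lambda>t. tensor_form k a (\<lambda>j. x j t) i)"
proof -
  have "continuous_on T (\<lambda>t. \<Prod>j\<leftarrow>js. x j t)" for js
    by (induction js) (auto intro!: continuous_intros assms)
  then show ?thesis
    unfolding tensor_form_def by (intro continuous_intros)
qed

text \<open>
  The last assumption is strong connectivity of the digraph of \<open>a\<close>, phrased without paths:
  every maximum principle below amounts to checking that an extremal set is closed under arcs.
\<close>

locale irreducible_tensor =
  fixes k :: nat and a :: "'n::finite list \<Rightarrow> real"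
  assumes degree_pos: "k \<ge> 1"
    and entry_nonneg: "length js = k \<Longrightarrow> a (i # js) \<ge> 0"
    and arc_closed_eq_UNIV:
      "S \<noteq> {} \<Longrightarrow> (\<And>i js. i \<in> S \<Longrightarrow> length js = k \<Longrightarrow> a (i # js) \<noteq> 0 \<Longrightarrow> set js \<subseteq> S) \<Longrightarrow> S = UNIV"
begin

abbreviation F :: "('n \<Rightarrow> real) \<Rightarrow> 'n \<Rightarrow> real" where
  "F \<equiv> tensor_form k a"

lemma form_nonneg: "(\<And>j. x j \<ge> 0) \<Longrightarrow> F x i \<ge> 0"
  unfolding tensor_form_def by (intro sum_nonneg mult_nonneg_nonneg prod_list_map_nonneg entry_nonneg) auto

lemma term_le_form:
  assumes "\<And>j. x j \<ge> 0" "length js = k"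
  shows "a (i # js) * (\<Prod>j\<leftarrow>js. x j) \<le> F x i"
  unfolding tensor_form_def
  by (rule member_le_sum[of js _ "\<lambda>js. a (i # js) * (\<Prod>j\<leftarrow>js. x j)"])
    (use assms in \<open>auto intro!: mult_nonneg_nonneg prod_list_map_nonneg entry_nonneg finite_index_lists\<close>)

lemma form_mono:
  assumes "\<And>j. 0 \<le> x j \<and> x j \<le> y j"
  shows "F x i \<le> F y i"
  unfolding tensor_form_def
  by (intro sum_mono mult_left_mono prod_list_mono) (use assms entry_nonneg in auto)

lemma form_strict_mono:
  assumes "\<And>j. 0 \<le> x j \<and> x j \<le> y j \<and> 0 < y j"
    and "length js = k" "a (i # js) \<noteq> 0" "l \<in> set js" "x l < y l"
  shows "F x i < F y i"
  unfolding tensor_form_def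
proof (rule sum_strict_mono_ex1)
  show "\<forall>js\<in>{js. length js = k}. a (i # js) * (\<Prod>j\<leftarrow>js. x j) \<le> a (i # js) * (\<Prod>j\<leftarrow>js. y j)"
    using assms(1) entry_nonneg by (auto intro!: mult_left_mono prod_list_mono)
  have "(\<Prod>j\<leftarrow>js. x j) < (\<Prod>j\<leftarrow>js. y j)"
    using assms by (intro prod_list_strict_mono) auto
  moreover have "a (i # js) > 0"
    using assms(2,3) entry_nonneg[of js i] by simp
  ultimately show "\<exists>js\<in>{js. length js = k}.
      a (i # js) * (\<Prod>j\<leftarrow>js. x j) < a (i # js) * (\<Prod>j\<leftarrow>js. y j)"
    using assms(2) by auto
qed (rule finite_index_lists)

section \<open>Existence of a positive eigenvector\<close>

text \<open>
  As all coordinates are at least \<open>1\<close>, one nonzero entry \<open>a (j # js)\<close> with \<open>l \<in> set js\<close> gives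
  \<open>a (j # js) x l \<le> F x j \<le> R (x j)\<^sup>k\<close>. A bound for \<open>x j\<close> is thus passed on to \<open>x l\<close>, starting
  from the index where \<open>x\<close> takes the value \<open>1\<close>.
\<close>

lemma Harnack:
  assumes "R \<ge> 0"
  obtains C where "\<And>x j. (\<And>j. x j \<ge> 1) \<Longrightarrow> (\<exists>i. x i = 1) \<Longrightarrow> (\<And>i. F x i \<le> R * x i ^ k) \<Longrightarrow> x j \<le> C"
proof -
  define adm where "adm x \<longleftrightarrow> (\<forall>j. x j \<ge> 1) \<and> (\<forall>i. F x i \<le> R * x i ^ k)" for x
  have "\<exists>C. \<forall>x. adm x \<and> x i = 1 \<longrightarrow> x j \<le> C" for i j
  proof -
    define S where "S = {j. \<exists>C. \<forall>x. adm x \<and> x i = 1 \<longrightarrow> x j \<le> C}"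
    have "S = UNIV"
    proof (rule arc_closed_eq_UNIV)
      have "i \<in> S" unfolding S_def by auto
      then show "S \<noteq> {}" by auto
      fix j js assume j: "j \<in> S" "length js = k" "a (j # js) \<noteq> 0"
      then have a: "a (j # js) > 0" using entry_nonneg[of js j] by simp
      obtain C where C: "\<And>x. adm x \<Longrightarrow> x i = 1 \<Longrightarrow> x j \<le> C"
        using j(1) unfolding S_def by blast
      show "set js \<subseteq> S"
      proof
        fix l assume l: "l \<in> set js"
        have "x l \<le> R * C ^ k / a (j # js)" if x: "adm x" "x i = 1" for x
        proof -
          have ge: "x j \<ge> 1" for j using x unfolding adm_def by simp
          then have ge0: "x j \<ge> 0" for j by (meson order_trans zero_le_one)
          have "a (j # js) * x l \<le> a (j # js) * (\<Prod>j\<leftarrow>js. x j)"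
            using a l ge by (intro mult_left_mono member_le_prod_list) auto
          also have "\<dots> \<le> F x j"
            using ge0 j(2) by (rule term_le_form)
          also have "\<dots> \<le> R * x j ^ k" using x unfolding adm_def by simp
          also have "\<dots> \<le> R * C ^ k"
            using C[OF x] ge0 \<open>R \<ge> 0\<close> by (intro mult_left_mono power_mono) auto
          finally show ?thesis using a by (simp add: field_simps)
        qed
        then show "l \<in> S" unfolding S_def by blast
      qed
    qed
    then show ?thesis unfolding S_def by blast
  qed
  then obtain C where C: "\<And>i j x. adm x \<Longrightarrow> x i = 1 \<Longrightarrow> x j \<le> C i j" by metis
  show thesis
  proof (rule that)
    fix x :: "'n \<Rightarrow> real" and j
    assume x: "\<And>j. x j \<ge> 1" "\<exists>i. x i = 1" "\<And>i. F x i \<le> R * x i ^ k"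
    then obtain i where i: "x i = 1" by blast
    have "x j \<le> C i j" using x i C unfolding adm_def by simp
    also have "\<dots> \<le> Max (range (\<lambda>(i, j). C i j))"
      by (intro Max_ge) (auto intro!: image_eqI[of _ _ "(i, j)"])
    finally show "x j \<le> Max (range (\<lambda>(i, j). C i j))" .
  qed
qed

definition supersolution :: "real \<Rightarrow> ('n \<Rightarrow> real) \<Rightarrow> bool" where
  "supersolution r x \<longleftrightarrow> (\<forall>i. x i > 0) \<and> (\<forall>i. F x i \<le> r * x i ^ k)"

lemma supersolution_min_one:
  assumes "supersolution r x"
  obtains y where "supersolution r y" "\<And>j. y j \<ge> 1" "\<exists>i. y i = 1"
proof -
  define c where "c = Min (range x)"
  have "c \<in> range x" unfolding c_def by (rule Min_in) auto
  then obtain i where i: "c = x i" by blast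
  have c: "c > 0" using assms i unfolding supersolution_def by simp
  have le: "c \<le> x j" for j unfolding c_def by simp
  define y where "y = (\<lambda>j. inverse c * x j)"
  show thesis
  proof (rule that)
    show "y j \<ge> 1" for j using c le by (simp add: y_def field_simps)
    show "\<exists>i. y i = 1" using c i by (intro exI[of _ i]) (simp add: y_def)
    show "supersolution r y"
      using assms c unfolding supersolution_def y_def
      by (auto simp: tensor_form_scale power_mult_distrib mult.left_commute[of r]
          intro!: mult_left_mono)
  qed
qed

text \<open>
  The infimum of the Collatz--Wielandt numbers \<open>max\<^sub>i F x i / (x i)\<^sup>k\<close> over positive vectors is
  attained: after normalisation, the Harnack bound leaves a compact set of pairs \<open>(r, x)\<close>.
\<close>

lemma optimal_supersolution:
  obtains r x where "supersolution r x" "\<And>r' x'. supersolution r' x' \<Longrightarrow> r \<le> r'"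
proof -
  \<comment> \<open>With this \<open>R\<close> the constant vector \<open>1\<close> is a supersolution, so larger values of \<open>r\<close> are irrelevant.\<close>
  define R where "R = (\<Sum>i\<in>UNIV. F (\<lambda>_. 1) i)"
  have R: "R \<ge> 0" unfolding R_def by (intro sum_nonneg form_nonneg) auto
  have R1: "F (\<lambda>_. 1) i \<le> R" for i
    unfolding R_def by (rule member_le_sum) (auto intro: form_nonneg)
  obtain C where C: "\<And>x j. (\<And>j. x j \<ge> 1) \<Longrightarrow> (\<exists>i. x i = 1) \<Longrightarrow> (\<And>i. F x i \<le> R * x i ^ k) \<Longrightarrow> x j \<le> C"
    using Harnack[OF R] by blast
  have C1: "C \<ge> 1" using C[of "\<lambda>_. 1"] R1 by simp
  define K :: "(real \<times> (real ^ 'n)) set" where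
    "K = ({0..R} \<times> cbox (\<chi> _. 1) (\<chi> _. C)) \<inter>
         (\<Inter>i. {p. F (\<lambda>j. snd p $ j) i \<le> fst p * (snd p $ i) ^ k})"
  have "closed {p :: real \<times> (real ^ 'n). F (\<lambda>j. snd p $ j) i \<le> fst p * (snd p $ i) ^ k}" for i
    by (intro closed_Collect_le continuous_on_tensor_form continuous_intros)
  then have "compact K"
    unfolding K_def by (intro compact_Int_closed compact_Times closed_INT) auto
  moreover have "(R, \<chi> _. 1) \<in> K"
  proof -
    have "(($) (\<chi> _. 1) :: 'n \<Rightarrow> real) = (\<lambda>_. 1)" by (simp add: fun_eq_iff)
    then show ?thesis
      unfolding K_def using R R1 C1 by (auto simp: mem_box_cart)
  qed
  moreover have "continuous_on K fst" by (intro continuous_intros)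
  ultimately obtain p where p: "p \<in> K" "\<And>q. q \<in> K \<Longrightarrow> fst p \<le> fst q"
    using continuous_attains_inf[of K fst] by (metis empty_iff)
  show thesis
  proof (rule that)
    show "supersolution (fst p) (\<lambda>j. snd p $ j)"
      using p(1) unfolding K_def supersolution_def
      by (auto simp: mem_box_cart mem_Times_iff intro: less_le_trans[OF zero_less_one])
  next
    fix r' x' assume x': "supersolution r' x'"
    show "fst p \<le> r'"
    proof (cases "r' \<le> R")
      case True
      obtain y where y: "supersolution r' y" "\<And>j. y j \<ge> 1" "\<exists>i. y i = 1"
        using supersolution_min_one[OF x'] by blast
      have pos: "y j > 0" for j using y unfolding supersolution_def by simp
      have sup: "F y i \<le> r' * y i ^ k" for i using y unfolding supersolution_def by simp
      have "F y i \<le> R * y i ^ k" for i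
        using sup[of i] mult_right_mono[OF True, of "y i ^ k"] pos[of i]
        by (meson less_imp_le order_trans zero_le_power)
      then have "y j \<le> C" for j using C y by blast
      moreover have "r' \<ge> 0"
      proof -
        have "0 \<le> F y undefined" by (intro form_nonneg less_imp_le pos)
        also have "\<dots> \<le> r' * y undefined ^ k" by (rule sup)
        finally show ?thesis
          using zero_less_power[OF pos[of undefined], of k] by (simp add: zero_le_mult_iff)
      qed
      moreover have "($) (\<chi> j. y j) = y" by (simp add: fun_eq_iff)
      ultimately have "(r', \<chi> j. y j) \<in> K"
        unfolding K_def using True y sup by (auto simp: mem_box_cart)
      from p(2)[OF this] show ?thesis by simp
    next
      case False
      then show ?thesis using p(1) unfolding K_def by (auto simp: mem_Times_iff)
    qed
  qed
qed

text \<open>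
  An optimal supersolution need not be an eigenvector, but one with the fewest tight
  coordinates, those with \<open>F x i = r (x i)\<^sup>k\<close>, is. Some coordinate is tight, for otherwise \<open>r\<close>
  could be decreased. If a slack coordinate \<open>l\<close> occurs in a nonzero entry of a tight row \<open>i\<close>,
  lowering \<open>x l\<close> a little keeps row \<open>l\<close> slack, makes row \<open>i\<close> slack and tightens no row, against
  the choice of \<open>x\<close>. So the set of tight rows is closed under arcs.
\<close>

lemma Perron_vector:
  obtains u r where "\<And>i. u i > 0" "\<And>i. F u i = r * u i ^ k"
proof -
  obtain r x0 where x0: "supersolution r x0" and least: "\<And>r' x'. supersolution r' x' \<Longrightarrow> r \<le> r'"
    using optimal_supersolution by blast
  define I where "I x = {i. F x i = r * x i ^ k}" for x
  obtain x where x: "supersolution r x" and fewest: "\<And>y. supersolution r y \<Longrightarrow> card (I x) \<le> card (I y)"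
    using ex_has_least_nat[of "supersolution r" x0 "\<lambda>x. card (I x)"] x0 by blast
  have pos: "x i > 0" and le: "F x i \<le> r * x i ^ k" for i
    using x unfolding supersolution_def by auto
  have "I x = UNIV"
  proof (rule arc_closed_eq_UNIV)
    show "I x \<noteq> {}"
    proof
      assume "I x = {}"
      then have less: "F x i < r * x i ^ k" for i
        using le[of i] unfolding I_def by (auto simp: less_le)
      define r' where "r' = Max (range (\<lambda>i. F x i / x i ^ k))"
      have "F x i \<le> r' * x i ^ k" for i
      proof -
        have "F x i / x i ^ k \<le> r'" unfolding r'_def by simp
        then show ?thesis using pos[of i] by (simp add: field_simps)
      qed
      then have "supersolution r' x"
        using pos unfolding supersolution_def by simp
      then have "r \<le> r'" by (rule least)
      moreover have "r' < r"
        unfolding r'_def using less pos by (subst Max_less_iff) (auto simp: field_simps)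
      ultimately show False by simp
    qed
  next
    fix i js assume i: "i \<in> I x" and js: "length js = k" "a (i # js) \<noteq> 0"
    show "set js \<subseteq> I x"
    proof (rule ccontr)
      assume "\<not> set js \<subseteq> I x"
      then obtain l where l: "l \<in> set js" "l \<notin> I x" by blast
      have less: "F x l < r * x l ^ k"
        using l(2) le[of l] unfolding I_def by (auto simp: less_le)
      have "isCont (\<lambda>c. r * c ^ k) (x l)" by (intro continuous_intros)
      then have "((\<lambda>c. r * c ^ k) \<longlongrightarrow> r * x l ^ k) (at_left (x l))"
        by (simp add: isCont_def filterlim_at_split)
      then have "\<forall>\<^sub>F c in at_left (x l). F x l < r * c ^ k"
        using less by (rule order_tendstoD)
      moreover have "\<forall>\<^sub>F c in at_left (x l). c \<in> {0<..<x l}"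
        by (rule eventually_at_leftI[OF _ pos])
      ultimately have "\<forall>\<^sub>F c in at_left (x l). F x l < r * c ^ k \<and> c \<in> {0<..<x l}"
        by (rule eventually_conj)
      then obtain c where c: "F x l < r * c ^ k" "0 < c" "c < x l"
        using eventually_happens'[OF trivial_limit_at_left_real] by fastforce
      define y where "y = x(l := c)"
      have ypos: "y j > 0" and yx: "y j \<le> x j" for j
        using pos c by (auto simp: y_def less_imp_le)
      have Fyx: "F y j \<le> F x j" for j
        using ypos yx by (intro form_mono) (auto simp: less_imp_le)
      have yl: "F y l < r * y l ^ k"
        using le_less_trans[OF Fyx c(1)] by (simp add: y_def)
      have "F y j \<le> r * y j ^ k" for j
        using yl order_trans[OF Fyx le, of j] by (cases "j = l") (auto simp: y_def)
      then have "card (I x) \<le> card (I y)"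
        using ypos by (intro fewest) (simp add: supersolution_def)
      moreover have "card (I y) < card (I x)"
      proof (rule psubset_card_mono)
        have "j \<in> I x" if "j \<in> I y" for j
        proof -
          have "j \<noteq> l" using that yl unfolding I_def by auto
          then have "F y j = r * x j ^ k" using that unfolding I_def by (simp add: y_def)
          then show ?thesis using Fyx[of j] le[of j] unfolding I_def by simp
        qed
        moreover have "i \<notin> I y"
        proof
          assume "i \<in> I y"
          then have "F y i = r * x i ^ k" using i l yl unfolding I_def by (auto simp: y_def)
          moreover have "F y i < F x i"
            using js l(1) c ypos yx pos
            by (intro form_strict_mono[where l = l]) (auto simp: y_def less_imp_le)
          ultimately show False using i unfolding I_def by simp
        qed
        ultimately show "I y \<subset> I x" using i by blast
      qed simp
      ultimately show False by simp
    qed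
  qed
  with pos show thesis unfolding I_def by (intro that[of x r]) auto
qed

section \<open>Comparison with the positive eigenvector\<close>

text \<open>
  Let \<open>t\<close> be the least factor with \<open>x \<le> t u\<close>. At an index with \<open>x i = t u i\<close> the inequalities
  \<open>s (x i)\<^sup>k \<le> F x i \<le> F (t u) i = r (t u i)\<^sup>k\<close> yield \<open>s \<le> r\<close>. If \<open>s = r\<close> they are equalities, and
  strict monotonicity of \<open>F\<close> spreads \<open>x = t u\<close> along the arcs.
\<close>

lemma subsolution_le_Perron:
  assumes u: "\<And>i. u i > 0" "\<And>i. F u i = r * u i ^ k"
    and x: "\<And>i. x i \<ge> 0" "\<exists>i. x i \<noteq> 0" "\<And>i. s * x i ^ k \<le> F x i"
  shows "s \<le> r"
    and "s = r \<Longrightarrow> \<exists>t>0. \<forall>i. x i = t * u i"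
proof -
  define t where "t = Max (range (\<lambda>i. x i / u i))"
  have "t \<in> range (\<lambda>i. x i / u i)" unfolding t_def by (rule Max_in) auto
  then obtain i where "t = x i / u i" by blast
  then have i: "x i = t * u i" using u(1)[of i] by simp
  have le: "x j \<le> t * u j" for j
  proof -
    have "x j / u j \<le> t" unfolding t_def by simp
    then show ?thesis using u(1)[of j] by (simp add: field_simps)
  qed
  obtain j where "x j \<noteq> 0" using x(2) by blast
  then have "0 < x j" using x(1)[of j] by simp
  also have "\<dots> \<le> t * u j" by (rule le)
  finally have t: "t > 0" using u(1)[of j] by (simp add: zero_less_mult_iff)
  have Fle: "F x j \<le> r * (t * u j) ^ k" for j
  proof -
    have "F x j \<le> F (\<lambda>j. t * u j) j" using x(1) le by (intro form_mono) auto
    then show ?thesis by (simp add: tensor_form_scale u(2) power_mult_distrib mult_ac)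
  qed
  have "s * (t * u i) ^ k \<le> r * (t * u i) ^ k"
    using x(3)[of i] Fle[of i] i by simp
  then show "s \<le> r" using t u(1)[of i] by simp
  assume "s = r"
  have "{j. x j = t * u j} = UNIV"
  proof (rule arc_closed_eq_UNIV)
    show "{j. x j = t * u j} \<noteq> {}" using i by auto
    fix i js assume i: "i \<in> {j. x j = t * u j}" and js: "length js = k" "a (i # js) \<noteq> 0"
    show "set js \<subseteq> {j. x j = t * u j}"
    proof (rule ccontr)
      assume "\<not> ?thesis"
      then obtain l where l: "l \<in> set js" "x l < t * u l" using le by (force simp: less_le)
      have "F x i < F (\<lambda>j. t * u j) i"
        using js l x(1) le t u(1) by (intro form_strict_mono) auto
      then have "F x i < r * x i ^ k"
        using i by (simp add: tensor_form_scale u(2) power_mult_distrib mult_ac)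
      then show False using x(3)[of i] \<open>s = r\<close> by simp
    qed
  qed
  with t show "\<exists>t>0. \<forall>i. x i = t * u i" by blast
qed

section \<open>Phases of eigenvectors\<close>

definition phase_solution :: "('n \<Rightarrow> complex) \<Rightarrow> bool" where
  "phase_solution y \<longleftrightarrow> (\<forall>i. cmod (y i) = 1) \<and>
     (\<forall>i js. length js = k \<longrightarrow> a (i # js) \<noteq> 0 \<longrightarrow> (\<Prod>j\<leftarrow>js. y j) = y i ^ k)"

text \<open>
  Near \<open>1\<close> the multiplicative system is equivalent to the linear system for the arguments,
  whose only solutions are the constants, by the maximum principle.
\<close>

lemma phase_near_one:
  obtains e where "e > 0"
    and "\<And>z i0. phase_solution z \<Longrightarrow> z i0 = 1 \<Longrightarrow> (\<And>i. dist (z i) 1 < e) \<Longrightarrow> z = (\<lambda>_. 1)"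
proof -
  have "continuous (at 1) Arg" by (rule continuous_at_Arg) (simp add: complex_nonpos_Reals_iff)
  \<comment> \<open>With \<open>\<bar>\<theta> j\<bar> < pi / k\<close>, the two sides of the linear equation differ by less than \<open>2 * pi\<close>.\<close>
  moreover have "pi / real k > 0" using degree_pos by simp
  ultimately obtain e where e: "e > 0" "\<And>z. dist z 1 < e \<Longrightarrow> \<bar>Arg z\<bar> < pi / real k"
    unfolding continuous_at_eps_delta dist_real_def by (metis Arg_1 diff_zero)
  show thesis
  proof (rule that[OF e(1)])
    fix z i0 assume z: "phase_solution z" "z i0 = 1" "\<And>i. dist (z i) 1 < e"
    define \<theta> where "\<theta> i = Arg (z i)" for i
    have small: "\<bar>\<theta> i\<bar> < pi / real k" for i using e(2)[OF z(3)] by (simp add: \<theta>_def)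
    have zc: "z i = cis (\<theta> i)" for i
      using z(1) rcis_cmod_Arg[of "z i"] by (simp add: phase_solution_def \<theta>_def rcis_def)
    have lin: "(\<Sum>j\<leftarrow>js. \<theta> j) = real k * \<theta> i" if "length js = k" "a (i # js) \<noteq> 0" for i js
    proof (rule cis_inj_near)
      have "(\<Prod>j\<leftarrow>js. z j) = z i ^ k" using z(1) that unfolding phase_solution_def by blast
      then show "cis (\<Sum>j\<leftarrow>js. \<theta> j) = cis (real k * \<theta> i)"
        by (simp add: zc prod_list_cis Complex.DeMoivre)
      define M where "M = Max (range (\<lambda>j. \<bar>\<theta> j\<bar>))"
      have le: "\<bar>\<theta> j\<bar> \<le> M" for j unfolding M_def by simp
      have "M < pi / real k" unfolding M_def using small by (subst Max_less_iff) auto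
      then have M: "real k * M < pi" using degree_pos by (simp add: field_simps)
      have "\<bar>\<Sum>j\<leftarrow>js. \<theta> j\<bar> \<le> real k * M" using abs_sum_list_le[of js \<theta> M] le that by simp
      moreover have "\<bar>real k * \<theta> i\<bar> \<le> real k * M" using le by (simp add: abs_mult mult_left_mono)
      ultimately show "\<bar>(\<Sum>j\<leftarrow>js. \<theta> j) - real k * \<theta> i\<bar> < 2 * pi" using M by linarith
    qed
    define T where "T = Max (range \<theta>)"
    have T: "\<theta> j \<le> T" for j unfolding T_def by simp
    have "{j. \<theta> j = T} = UNIV"
    proof (rule arc_closed_eq_UNIV)
      have "T \<in> range \<theta>" unfolding T_def by (rule Max_in) auto
      then show "{j. \<theta> j = T} \<noteq> {}" by auto
      fix i js assume i: "i \<in> {j. \<theta> j = T}" and js: "length js = k" "a (i # js) \<noteq> 0"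
      show "set js \<subseteq> {j. \<theta> j = T}"
        using sum_list_max_imp_eq[of js \<theta> T] T lin[OF js] i js(1) by auto
    qed
    then have "\<theta> i = \<theta> i0" for i by (metis (mono_tags) UNIV_I mem_Collect_eq)
    then have "z i = z i0" for i unfolding zc by metis
    then show "z = (\<lambda>_. 1)" unfolding z(2) by blast
  qed
qed

lemma phase_solution_divide:
  assumes "phase_solution y" "phase_solution z"
  shows "phase_solution (\<lambda>i. y i / z i)"
proof -
  have "(\<Prod>j\<leftarrow>js. inverse (z j)) = inverse (\<Prod>j\<leftarrow>js. z j)" for js
    by (induction js) auto
  then show ?thesis
    using assms unfolding phase_solution_def
    by (auto simp: norm_divide divide_inverse prod_list_mult power_mult_distrib power_inverse norm_mult norm_inverse)
qed

text \<open>
  Solutions form a group under pointwise multiplication, so the neighbourhood of \<open>1\<close> without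
  other normalised solutions can be translated: any two of them are at least \<open>e\<close> apart.
\<close>

lemma finite_phase_solutions: "finite {y. phase_solution y \<and> y i0 = 1}"
proof -
  obtain e where e: "e > 0"
    and e': "\<And>z i0. phase_solution z \<Longrightarrow> z i0 = 1 \<Longrightarrow> (\<And>i. dist (z i) 1 < e) \<Longrightarrow> z = (\<lambda>_. 1)"
    using phase_near_one by blast
  define Y where "Y = vec_lambda ` {y. phase_solution y \<and> y i0 = 1}"
  have Y: "phase_solution (($) v)" "v $ i0 = 1" if "v \<in> Y" for v
    using that unfolding Y_def by (auto simp: vec_lambda_inverse eta_contract_eq)
  have sep: "v = w" if "v \<in> Y" "w \<in> Y" "dist v w < e" for v w
  proof -
    have w1: "cmod (w $ i) = 1" for i using Y[OF that(2)] unfolding phase_solution_def by simp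
    then have w0: "w $ i \<noteq> 0" for i by (metis norm_zero zero_neq_one)
    have "dist (v $ i / w $ i) 1 < e" for i
    proof -
      have "v $ i / w $ i - 1 = (v $ i - w $ i) / w $ i" using w0 by (simp add: field_simps)
      then have "dist (v $ i / w $ i) 1 = dist (v $ i) (w $ i)"
        by (simp add: dist_norm norm_divide w1)
      then show ?thesis using dist_vec_nth_le[of v i w] that(3) by simp
    qed
    then have "(\<lambda>i. v $ i / w $ i) = (\<lambda>_. 1)"
      using Y that by (intro e'[of _ i0] phase_solution_divide) auto
    then show ?thesis using w0 by (auto simp: vec_eq_iff fun_eq_iff)
  qed
  have "bounded Y"
    unfolding bounded_iff
  proof (intro exI ballI)
    fix v assume "v \<in> Y"
    then have "cmod (v $ i) = 1" for i using Y unfolding phase_solution_def by blast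
    then show "norm v \<le> real CARD('n)"
      using L2_set_le_sum[of UNIV "\<lambda>i. cmod (v $ i)"] by (simp add: norm_vec_def)
  qed
  moreover have "uniform_discrete Y"
    using e sep unfolding uniform_discrete_def by blast
  ultimately have "finite Y" using uniform_discrete_finite_iff by blast
  then show ?thesis unfolding Y_def by (rule finite_imageD) (auto simp: inj_on_def vec_lambda_inject)
qed

section \<open>Complex eigenvectors for the spectral radius\<close>

abbreviation FC :: "('n \<Rightarrow> complex) \<Rightarrow> 'n \<Rightarrow> complex" where
  "FC \<equiv> tensor_form k (\<lambda>js. complex_of_real (a js))"

lemma complex_form_of_real: "FC (\<lambda>j. complex_of_real (x j)) i = complex_of_real (F x i)"
  unfolding tensor_form_def by (simp add: of_real_prod_list)

lemma norm_form_le: "cmod (FC x i) \<le> F (\<lambda>j. cmod (x j)) i"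
  unfolding tensor_form_def
  by (rule order_trans[OF norm_sum], intro sum_mono) (simp add: norm_mult norm_prod_list entry_nonneg)

lemma eigenvector_subsolution:
  assumes "\<And>i. FC x i = \<mu> * x i ^ k"
  shows "cmod \<mu> * cmod (x i) ^ k \<le> F (\<lambda>j. cmod (x j)) i"
  using norm_form_le[of x i] by (simp add: assms norm_mult norm_power)

text \<open>
  Since \<open>\<bar>x\<bar> = t u\<close>, the eigenvalue equation at \<open>i\<close> says that the weighted mean of the products
  \<open>y j\<^sub>1 \<cdots> y j\<^sub>k\<close>, with weights \<open>a (i # js) (t u j\<^sub>1) \<cdots> (t u j\<^sub>k)\<close>, is the unit number \<open>(y i)\<^sup>k\<close>.
  For \<open>r = 0\<close> all the weights vanish, and the equations for the phases are vacuous.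
\<close>

lemma Perron_eigenvector_polar:
  assumes u: "\<And>i. u i > 0" "\<And>i. F u i = r * u i ^ k" and "r \<ge> 0"
    and x: "\<And>i. FC x i = of_real r * x i ^ k" "\<exists>i. x i \<noteq> 0"
  obtains t y where "t > 0" "phase_solution y" "\<And>i. x i = of_real (t * u i) * y i"
proof -
  have "\<exists>t>0. \<forall>i. cmod (x i) = t * u i"
    using subsolution_le_Perron(2)[OF u, of "\<lambda>i. cmod (x i)" r] x(2)
      eigenvector_subsolution[OF x(1)] \<open>r \<ge> 0\<close> by auto
  then obtain t where t: "t > 0" "\<And>i. cmod (x i) = t * u i" by blast
  define y where "y i = x i / of_real (t * u i)" for i
  have tu: "t * u i > 0" for i using t(1) u(1) by simp
  have xy: "x i = of_real (t * u i) * y i" for i using t(1) u(1)[of i] by (simp add: y_def)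
  have y1: "cmod (y i) = 1" for i
    unfolding y_def norm_divide t(2) norm_of_real using t(1) u(1)[of i] by simp
  have "(\<Prod>j\<leftarrow>js. y j) = y i ^ k" if js: "length js = k" "a (i # js) \<noteq> 0" for i js
  proof -
    let ?w = "\<lambda>js. a (i # js) * (\<Prod>j\<leftarrow>js. t * u j)"
    show ?thesis
    proof (rule weighted_mean_extreme[where S = "{js. length js = k}" and w = ?w
          and z = "\<lambda>js. \<Prod>j\<leftarrow>js. y j"])
    show "finite {js :: 'n list. length js = k}" by (rule finite_index_lists)
    show "?w js \<ge> 0" if "js \<in> {js. length js = k}" for js
      using that t(1) u(1) by (intro mult_nonneg_nonneg entry_nonneg prod_list_map_nonneg) (simp_all add: less_imp_le)
    show "?w js \<noteq> 0" using js prod_list_map_pos[of js "\<lambda>j. t * u j"] tu by auto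
    show "cmod (\<Prod>j\<leftarrow>js. y j) = 1" if "js \<in> {js. length js = k}" for js
      unfolding norm_prod_list by (induction js) (simp_all add: norm_mult y1)
    show "cmod (y i ^ k) = 1" by (simp add: norm_power y1)
    show "js \<in> {js. length js = k}" using js by simp
    have "(\<Sum>js | length js = k. of_real (?w js) * (\<Prod>j\<leftarrow>js. y j)) = FC x i"
      unfolding tensor_form_def xy by (simp add: of_real_prod_list prod_list_mult mult.assoc)
    also have "\<dots> = of_real (r * (t * u i) ^ k) * y i ^ k"
      unfolding x(1) xy by (simp add: power_mult_distrib)
    also have "r * (t * u i) ^ k = F (\<lambda>j. t * u j) i"
      by (simp add: tensor_form_scale u(2) power_mult_distrib)
    finally show "(\<Sum>js | length js = k. of_real (?w js) * (\<Prod>j\<leftarrow>js. y j)) =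
        of_real (\<Sum>js | length js = k. ?w js) * y i ^ k"
      unfolding tensor_form_def .
    qed
  qed
  then have "phase_solution y" using y1 unfolding phase_solution_def by blast
  with t(1) xy show thesis using that by blast
qed

lemma finite_Perron_lines:
  assumes u: "\<And>i. u i > 0" "\<And>i. F u i = r * u i ^ k" and "r \<ge> 0"
  shows "finite {vec.span {x} | x. x \<noteq> 0 \<and> (\<forall>i. FC (($) x) i = of_real r * (x $ i) ^ k)}"
proof (rule finite_subset)
  \<comment> \<open>Any index serves to normalise the phases, as no eigenvector for \<open>r\<close> has a zero coordinate.\<close>
  define i0 :: 'n where "i0 = undefined"
  let ?line = "\<lambda>y. vec.span {\<chi> i. of_real (u i) * y i}"
  show "finite (?line ` {y. phase_solution y \<and> y i0 = 1})"
    by (intro finite_imageI finite_phase_solutions)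
  show "{vec.span {x} | x. x \<noteq> 0 \<and> (\<forall>i. FC (($) x) i = of_real r * (x $ i) ^ k)}
      \<subseteq> ?line ` {y. phase_solution y \<and> y i0 = 1}"
  proof clarify
    fix x :: "complex ^ 'n" assume x: "x \<noteq> 0" "\<forall>i. FC (($) x) i = of_real r * (x $ i) ^ k"
    obtain t y where ty: "t > 0" "phase_solution y" "\<And>i. x $ i = of_real (t * u i) * y i"
      using Perron_eigenvector_polar[OF u \<open>r \<ge> 0\<close>, of "($) x"] x by (auto simp: vec_eq_iff)
    have n0: "cmod (y i0) = 1" using ty(2) unfolding phase_solution_def by blast
    then have y0: "y i0 \<noteq> 0" by auto
    have "phase_solution (\<lambda>_. y i0)"
    proof -
      have "(\<Prod>j\<leftarrow>js. y i0) = y i0 ^ length js" for js :: "'n list" by (induction js) auto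
      then show ?thesis unfolding phase_solution_def using n0 by auto
    qed
    then have "phase_solution (\<lambda>i. y i / y i0)" using ty(2) by (intro phase_solution_divide)
    moreover have "x = (of_real t * y i0) *s (\<chi> i. of_real (u i) * (y i / y i0))"
      using y0 by (simp add: vec_eq_iff ty(3))
    ultimately show "vec.span {x} \<in> ?line ` {y. phase_solution y \<and> y i0 = 1}"
      using ty(1) y0 by (intro image_eqI[of _ _ "\<lambda>i. y i / y i0"]) (simp_all add: span_singleton_scale)
  qed
qed

end

section \<open>Finite subsets of projective space have dimension zero\<close>

lemma homogeneous_poly_add:
  assumes "homogeneous_poly d f" "homogeneous_poly d g"
  shows "homogeneous_poly d (\<lambda>x. f x + g x)"
proof -
  obtain b c where "\<And>x. f x = (\<Sum>\<alpha> | (\<Sum>i\<in>UNIV. \<alpha> i) = d. b \<alpha> * (\<Prod>i\<in>UNIV. (x $ i) ^ \<alpha> i))"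
    "\<And>x. g x = (\<Sum>\<alpha> | (\<Sum>i\<in>UNIV. \<alpha> i) = d. c \<alpha> * (\<Prod>i\<in>UNIV. (x $ i) ^ \<alpha> i))"
    using assms unfolding homogeneous_poly_def by blast
  then show ?thesis
    unfolding homogeneous_poly_def
    by (intro exI[of _ "\<lambda>\<alpha>. b \<alpha> + c \<alpha>"]) (simp add: sum.distrib ring_distribs)
qed

lemma homogeneous_poly_coordinate:
  "homogeneous_poly 1 (\<lambda>x :: complex ^ 'n::finite. x $ q)"
proof -
  define \<epsilon> :: "'n \<Rightarrow> nat" where "\<epsilon> = (\<lambda>i. if i = q then 1 else 0)"
  have mem: "\<epsilon> \<in> {\<alpha>. (\<Sum>i\<in>UNIV. \<alpha> i) = 1}" by (simp add: \<epsilon>_def)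
  have "(\<Sum>\<alpha> | (\<Sum>i\<in>UNIV. \<alpha> i) = 1. (if \<alpha> = \<epsilon> then 1 else 0) * (\<Prod>i\<in>UNIV. (x $ i) ^ \<alpha> i)) = x $ q"
    for x :: "complex ^ 'n"
  proof -
    have "(\<Sum>\<alpha> | (\<Sum>i\<in>UNIV. \<alpha> i) = 1. (if \<alpha> = \<epsilon> then 1 else 0) * (\<Prod>i\<in>UNIV. (x $ i) ^ \<alpha> i)) =
      (\<Sum>\<alpha> | (\<Sum>i\<in>UNIV. \<alpha> i) = 1. if \<alpha> = \<epsilon> then (\<Prod>i\<in>UNIV. (x $ i) ^ \<alpha> i) else 0)"
      by (intro sum.cong) auto
    also have "\<dots> = (\<Prod>i\<in>UNIV. (x $ i) ^ \<epsilon> i)"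
      using mem by (subst sum.delta[OF finite_exponents]) (simp only: if_True)
    also have "\<dots> = (\<Prod>i\<in>UNIV. if i = q then x $ i else 1)"
      by (intro prod.cong) (auto simp: \<epsilon>_def)
    finally show ?thesis by simp
  qed
  then show ?thesis
    unfolding homogeneous_poly_def by (intro exI[of _ "\<lambda>\<alpha>. if \<alpha> = \<epsilon> then 1 else 0"]) simp
qed

text \<open>The line through \<open>v\<close> is cut out by the minors \<open>v p * x q - v q * x p\<close>, for one \<open>p\<close> with \<open>v p \<noteq> 0\<close>.\<close>

lemma t1_space_zariski: "t1_space (zariski_topology :: (complex ^ 'n::finite) set topology)"
  unfolding t1_space_closedin_singleton topspace_zariski closedin_zariski
proof
  fix L :: "(complex ^ 'n) set" assume L: "L \<in> projective_space"
  then obtain v where v: "v \<noteq> 0" "L = vec.span {v}" unfolding projective_space_def by blast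
  then obtain p where p: "v $ p \<noteq> 0" by (auto simp: vec_eq_iff)
  define f where "f q x = v $ p * x $ q + (- v $ q) * x $ p" for q and x :: "complex ^ 'n"
  have lin: "homogeneous_poly 1 (\<lambda>x :: complex ^ 'n. c * x $ q)" for c q
    using homogeneous_poly_mult[OF homogeneous_poly_const homogeneous_poly_coordinate, of c q] by simp
  have hom: "homogeneous_poly 1 (f q)" for q
    unfolding f_def by (intro homogeneous_poly_add lin)
  have "{L} = proj_zero_locus (range f)"
  proof
    have "f q x = 0" if "x \<in> L" for q x
      using that unfolding v(2) vec.span_singleton by (auto simp: f_def)
    then show "{L} \<subseteq> proj_zero_locus (range f)"
      using L unfolding proj_zero_locus_def by auto
    show "proj_zero_locus (range f) \<subseteq> {L}"
    proof
      fix M assume M: "M \<in> proj_zero_locus (range f)"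
      then obtain w where w: "w \<noteq> 0" "M = vec.span {w}"
        unfolding proj_zero_locus_def projective_space_def by blast
      have "w \<in> M" unfolding w(2) by (simp add: vec.span_base)
      then have "f q w = 0" for q using M unfolding proj_zero_locus_def by blast
      then have eq: "v $ p * w $ q = v $ q * w $ p" for q unfolding f_def by simp
      have "w $ q = w $ p / v $ p * v $ q" for q
      proof -
        have "w $ q * v $ p = w $ p * v $ q" using eq[of q] by (simp only: mult.commute)
        then show ?thesis using p by (simp add: eq_divide_eq)
      qed
      then have "w = (w $ p / v $ p) *s v" 
        unfolding vec_eq_iff vector_smult_component by blast
      then obtain c where c: "w = c *s v" by blast
      then have c0: "c \<noteq> 0" using w(1) by auto
      have "vec.span {w} = vec.span {v}" unfolding c by (rule span_singleton_scale[OF c0])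
      then show "M \<in> {L}" using w v by simp
    qed
  qed
  then show "proj_algebraic_set {L}"
    unfolding proj_algebraic_set_def using hom by (intro exI[of _ "range f"]) auto
qed

text \<open>
  All subsets of such a space are closed, so its irreducible subsets are singletons, which admit
  no proper inclusions; a chain of length \<open>0\<close> exists because the space is nonempty.
\<close>

lemma finite_t1_dimension_zero:
  assumes "t1_space X" "finite (topspace X)" "topspace X \<noteq> {}"
  shows "topological_dimension X = 0"
proof -
  let ?chain = "\<lambda>k (Z :: nat \<Rightarrow> 'a set). (\<forall>i\<le>k. closedin X (Z i) \<and> irreducible_in X (Z i)) \<and>
    (\<forall>i<k. Z i \<subset> Z (Suc i))"
  have closed: "closedin X S" if "S \<subseteq> topspace X" for S
    using assms(1) that finite_subset[OF that assms(2)] by (simp add: t1_space_closedin_finite)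
  have single: "\<exists>p. Z = {p}" if Z: "irreducible_in X Z" for Z
  proof -
    obtain p where p: "p \<in> Z" using Z unfolding irreducible_in_def by blast
    have "closedin X {p}" "closedin X (Z - {p})"
      using Z p unfolding irreducible_in_def by (auto intro!: closed)
    moreover have "Z \<subseteq> {p} \<union> (Z - {p})" by blast
    ultimately have "Z \<subseteq> {p} \<or> Z \<subseteq> Z - {p}" using Z unfolding irreducible_in_def by blast
    then show ?thesis using p by blast
  qed
  obtain p where p: "p \<in> topspace X" using assms(3) by blast
  have base: "?chain 0 (\<lambda>_. {p})" using p closed by (auto simp: irreducible_in_def)
  have only: "k = 0" if "?chain k Z" for k Z
  proof (rule ccontr)
    assume "k \<noteq> 0"
    then have "irreducible_in X (Z 0)" "irreducible_in X (Z (Suc 0))" "Z 0 \<subset> Z (Suc 0)"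
      using that by auto
    then obtain p q where "Z 0 = {p}" "Z (Suc 0) = {q}" using single by meson
    with \<open>Z 0 \<subset> Z (Suc 0)\<close> show False by auto
  qed
  have "(\<exists>Z. ?chain k Z) \<longleftrightarrow> k = 0" for k
  proof
    assume "\<exists>Z. ?chain k Z"
    then obtain Z where "?chain k Z" ..
    then show "k = 0" by (rule only)
  next
    assume "k = 0"
    then show "\<exists>Z. ?chain k Z" using base by (intro exI[of _ "\<lambda>_. {p}"]) simp
  qed
  then have "{ereal (real k) | k. \<exists>Z. ?chain k Z} = {0}"
    by (simp add: zero_ereal_def)
  then show ?thesis unfolding topological_dimension_def by simp
qed

section \<open>The eigenvariety\<close>

lemma projective_eigenvariety_eq_lines:
  fixes A :: "'n::finite tensor"
  shows "projective_eigenvariety m A \<mu> = {vec.span {x} | x. is_eigenvector m A \<mu> x}"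
proof -
  have scale: "tensor_apply m A (c *s x) = \<mu> *s hadamard_power (c *s x) (m - 1)"
    if "tensor_apply m A x = \<mu> *s hadamard_power x (m - 1)" for c and x :: "complex ^ 'n"
  proof -
    have "tensor_apply m A (c *s x) $ i = c ^ (m - 1) * tensor_apply m A x $ i" for i
      using tensor_form_scale[of "m - 1" A c "($) x" i] by (simp add: tensor_apply_def tensor_form_def)
    then show ?thesis
      by (simp add: that vec_eq_iff hadamard_power_def power_mult_distrib)
  qed
  show ?thesis
    unfolding projective_eigenvariety_def projective_space_def is_eigenvector_def
  proof (intro set_eqI iffI; clarify)
    fix x :: "complex ^ 'n"
    assume "x \<noteq> 0" "\<forall>y\<in>vec.span {x}. tensor_apply m A y = \<mu> *s hadamard_power y (m - 1)"
    then show "\<exists>y. vec.span {x} = vec.span {y} \<and> y \<noteq> 0 \<and>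
        tensor_apply m A y = \<mu> *s hadamard_power y (m - 1)"
      by (intro exI[of _ x]) (auto intro: vec.span_base)
  next
    fix x :: "complex ^ 'n"
    assume "x \<noteq> 0" "tensor_apply m A x = \<mu> *s hadamard_power x (m - 1)"
    then show "vec.span {x} \<in> {vec.span {x} | x. x \<noteq> 0} \<and>
       (\<forall>y\<in>vec.span {x}. tensor_apply m A y = \<mu> *s hadamard_power y (m - 1))"
      unfolding vec.span_singleton using scale by blast
  qed
qed

lemma irreducible_tensor_Re:
  fixes A :: "'n::finite tensor"
  assumes "m \<ge> 2" "nonneg_tensor m A" "weakly_irreducible m A"
  shows "irreducible_tensor (m - 1) (\<lambda>js. Re (A js))"
proof
  have real: "A (i # js) = of_real (Re (A (i # js))) \<and> Re (A (i # js)) \<ge> 0"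
    if "length js = m - 1" for i js
    using assms(1,2) that unfolding nonneg_tensor_def
    by (auto simp: complex_nonneg_Reals_iff complex_eq_iff)
  show "m - 1 \<ge> 1" using assms(1) by simp
  show "Re (A (i # js)) \<ge> 0" if "length js = m - 1" for i js
    using real that by blast
  fix S :: "'n set"
  assume "S \<noteq> {}" and closed: "\<And>i js. i \<in> S \<Longrightarrow> length js = m - 1 \<Longrightarrow> Re (A (i # js)) \<noteq> 0 \<Longrightarrow> set js \<subseteq> S"
  then obtain i where i: "i \<in> S" by blast
  have step: "q \<in> S" if p: "p \<in> S" and arc: "(p, q) \<in> arcs_ends (tensor_digraph m A)" for p q
  proof -
    obtain js where "length js = m - 1" "A (p # js) \<noteq> 0" "q \<in> set js"
      using arc by (auto simp: arcs_ends_def arc_to_ends_def tensor_digraph_def)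
    then show ?thesis using closed[OF p, of js] real[of js p] by (auto simp: complex_eq_iff)
  qed
  have "j \<in> S" for j
  proof -
    have "(i, j) \<in> rtrancl_on (verts (tensor_digraph m A)) (arcs_ends (tensor_digraph m A))"
      using assms(3) unfolding weakly_irreducible_def strongly_connected_def reachable_def
      by (auto simp: tensor_digraph_def)
    then show ?thesis by (induction rule: rtrancl_on_induct) (use i step in auto)
  qed
  then show "S = UNIV" by blast
qed

theorem theorem3p8:
  fixes m :: nat and A :: "'n::finite tensor"
  assumes "m \<ge> 2"
    and "nonneg_tensor m A"
    and "weakly_irreducible m A"
  defines "\<rho> \<equiv> complex_of_real (tensor_spectral_radius m A)"
  shows "topological_dimension
           (subtopology zariski_topology (projective_eigenvariety m A \<rho>)) = 0
         \<and> finite {vec.span {x} | x. is_eigenvector m A \<rho> x}"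
proof -
  interpret irreducible_tensor "m - 1" "\<lambda>js. Re (A js)"
    using assms(1-3) by (rule irreducible_tensor_Re)
  obtain u r where u: "\<And>i. u i > 0" "\<And>i. F u i = r * u i ^ (m - 1)"
    by (rule Perron_vector) (rule that)
  have r: "r \<ge> 0"
  proof -
    have "0 \<le> F u undefined" by (intro form_nonneg less_imp_le u)
    then have "0 \<le> r * u undefined ^ (m - 1)" unfolding u(2) .
    then show ?thesis
      using zero_less_power[OF u(1)[of undefined], of "m - 1"] by (simp add: zero_le_mult_iff)
  qed
  have entry: "A (i # js) = of_real (Re (A (i # js)))" if "length js = m - 1" for i js
    using assms(1,2) that unfolding nonneg_tensor_def
    by (auto simp: complex_nonneg_Reals_iff complex_eq_iff)
  have "tensor_apply m A x $ i = FC (($) x) i" for x i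
    unfolding tensor_apply_def tensor_form_def vec_lambda_beta
    by (intro sum.cong refl arg_cong2[where f = "(*)"] entry) simp
  then have eigen: "is_eigenvector m A \<mu> x \<longleftrightarrow> x \<noteq> 0 \<and> (\<forall>i. FC (($) x) i = \<mu> * (x $ i) ^ (m - 1))" for \<mu> x
    unfolding is_eigenvector_def hadamard_power_def by (simp add: vec_eq_iff)
  have Perron: "is_eigenvector m A (of_real r) (\<chi> i. of_real (u i))"
  proof -
    have "(($) (\<chi> i. complex_of_real (u i))) = (\<lambda>i. complex_of_real (u i))" by (simp add: fun_eq_iff)
    moreover have "(\<chi> i. complex_of_real (u i)) \<noteq> 0"
      using u(1) by (simp add: vec_eq_iff) (metis less_irrefl)
    ultimately show ?thesis
      unfolding eigen
      by (simp only: complex_form_of_real u(2) vec_lambda_beta of_real_mult of_real_power simp_thms)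
  qed
  have "tensor_spectral_radius m A = r"
    unfolding tensor_spectral_radius_def
  proof (rule cSup_eq_maximum)
    show "r \<in> cmod ` {\<mu>. is_eigenvalue m A \<mu>}"
      using Perron r by (intro image_eqI[of _ _ "of_real r"]) (auto simp: is_eigenvalue_def)
    fix s assume "s \<in> cmod ` {\<mu>. is_eigenvalue m A \<mu>}"
    then obtain \<mu> x where "s = cmod \<mu>" "x \<noteq> 0" "\<And>i. FC (($) x) i = \<mu> * (x $ i) ^ (m - 1)"
      unfolding is_eigenvalue_def eigen by blast
    then show "s \<le> r"
      using eigenvector_subsolution[of "($) x" \<mu>]
      by (intro subsolution_le_Perron(1)[OF u, of "\<lambda>i. cmod (x $ i)"]) (auto simp: vec_eq_iff)
  qed
  then have \<rho>: "\<rho> = of_real r" unfolding \<rho>_def by simp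
  have fin: "finite {vec.span {x} | x. is_eigenvector m A \<rho> x}"
    unfolding eigen \<rho> by (rule finite_Perron_lines[OF u r])
  let ?V = "projective_eigenvariety m A \<rho>"
  have "?V \<subseteq> projective_space" unfolding projective_eigenvariety_def by blast
  then have "topspace (subtopology zariski_topology ?V) = ?V"
    by (simp add: topspace_subtopology topspace_zariski inf.absorb2)
  moreover have "?V \<noteq> {}" "finite ?V"
    using Perron fin unfolding projective_eigenvariety_eq_lines \<rho> by auto
  ultimately have "topological_dimension (subtopology zariski_topology ?V) = 0"
    using t1_space_zariski by (intro finite_t1_dimension_zero t1_space_subtopology) auto
  with fin show ?thesis by blast
qed

end
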